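(* Let $A\in\{0,1\}^{N\times n}$ and suppose there exists a margin-$m$, relative-bias-$\tau$ embedding of $A$ in dimension $d$. Then there exists a margin-$\frac{m}{1+|\tau|}$, relative-bias-$0$ embedding of $A$ in dimension $d+1$, and $\frac{m}{1+|\tau|}\ge\frac m2$.
   Context: For $A\in\{0,1\}^{N\times n}$, $m\ge 0$ and $\tau\in\mathbb{R}$, unit vectors $U_1,\dots,U_N,V_1,\dots,V_n\in\mathbb{R}^d$ form a margin-$m$, relative-bias-$\tau$ embedding of $A$ in dimension $d$ if $\langle U_j,V_i\rangle\ge\tau+m$ whenever $A_{ji}=1$ and $\langle U_j,V_i\rangle\le\tau-m$ whenever $A_{ji}=0$. *)

theory Defs
  imports Complex_Main
begin

text \<open>Vectors of R^d are represented as functions nat => real vanishing outside {..<d}.\<close>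

definition dinner :: "nat \<Rightarrow> (nat \<Rightarrow> real) \<Rightarrow> (nat \<Rightarrow> real) \<Rightarrow> real" where
  "dinner d x y = (\<Sum>k<d. x k * y k)"

definition unit_vec :: "nat \<Rightarrow> (nat \<Rightarrow> real) \<Rightarrow> bool" where
  "unit_vec d x \<longleftrightarrow> (\<forall>k\<ge>d. x k = 0) \<and> dinner d x x = 1"

definition binary_matrix :: "nat \<Rightarrow> nat \<Rightarrow> (nat \<Rightarrow> nat \<Rightarrow> nat) \<Rightarrow> bool" where
  "binary_matrix N n A \<longleftrightarrow> (\<forall>j<N. \<forall>i<n. A j i \<in> {0, 1})"

definition is_embedding ::
  "nat \<Rightarrow> nat \<Rightarrow> (nat \<Rightarrow> nat \<Rightarrow> nat) \<Rightarrow> real \<Rightarrow> real \<Rightarrow> nat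
    \<Rightarrow> (nat \<Rightarrow> nat \<Rightarrow> real) \<Rightarrow> (nat \<Rightarrow> nat \<Rightarrow> real) \<Rightarrow> bool" where
  "is_embedding N n A m \<tau> d U V \<longleftrightarrow>
     (\<forall>j<N. unit_vec d (U j)) \<and> (\<forall>i<n. unit_vec d (V i)) \<and>
     (\<forall>j<N. \<forall>i<n. (A j i = 1 \<longrightarrow> dinner d (U j) (V i) \<ge> \<tau> + m) \<and>
                    (A j i = 0 \<longrightarrow> dinner d (U j) (V i) \<le> \<tau> - m))"

end

theory Submission
  imports Defs
begin

text \<open>Append to every vector one coordinate, \<open>sqrt \<bar>\<tau>\<bar>\<close> for the rows and
  \<open>-sgn \<tau> * sqrt \<bar>\<tau>\<bar>\<close> for the columns, and renormalise by \<open>sqrt (1 + \<bar>\<tau>\<bar>)\<close>.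
  The new coordinates contribute \<open>-\<tau>\<close> to every inner product, so
  \<open>\<langle>U'\<^sub>j, V'\<^sub>i\<rangle> = (\<langle>U\<^sub>j, V\<^sub>i\<rangle> - \<tau>) / (1 + \<bar>\<tau>\<bar>)\<close>: the threshold moves to 0
  and the margin shrinks by the factor \<open>1 + \<bar>\<tau>\<bar>\<close>.\<close>

definition lift_vec :: "nat \<Rightarrow> (nat \<Rightarrow> real) \<Rightarrow> real \<Rightarrow> real \<Rightarrow> nat \<Rightarrow> real" where
  "lift_vec d x a b = (\<lambda>k. if k < d then a * x k else if k = d then b else 0)"

lemma dinner_lift_vec:
  "dinner (Suc d) (lift_vec d x a b) (lift_vec d y c e) = a * c * dinner d x y + b * e"
proof -
  have "dinner (Suc d) (lift_vec d x a b) (lift_vec d y c e)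
      = (\<Sum>k<d. lift_vec d x a b k * lift_vec d y c e k) + b * e"
    by (simp add: dinner_def lift_vec_def)
  also have "(\<Sum>k<d. lift_vec d x a b k * lift_vec d y c e k) = (\<Sum>k<d. a * c * (x k * y k))"
    by (rule sum.cong) (auto simp: lift_vec_def)
  finally show ?thesis
    by (simp add: dinner_def sum_distrib_left)
qed

lemma unit_vec_lift_vec:
  assumes "unit_vec d x" and "a * a + b * b = 1"
  shows "unit_vec (Suc d) (lift_vec d x a b)"
  using assms dinner_lift_vec[of d x a b x a b] unfolding unit_vec_def
  by (auto simp: lift_vec_def)

definition debias_row :: "real \<Rightarrow> nat \<Rightarrow> (nat \<Rightarrow> real) \<Rightarrow> nat \<Rightarrow> real" where
  "debias_row \<tau> d x = lift_vec d x (1 / sqrt (1 + \<bar>\<tau>\<bar>)) (sqrt \<bar>\<tau>\<bar> / sqrt (1 + \<bar>\<tau>\<bar>))"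

definition debias_col :: "real \<Rightarrow> nat \<Rightarrow> (nat \<Rightarrow> real) \<Rightarrow> nat \<Rightarrow> real" where
  "debias_col \<tau> d y = lift_vec d y (1 / sqrt (1 + \<bar>\<tau>\<bar>)) (- sgn \<tau> * sqrt \<bar>\<tau>\<bar> / sqrt (1 + \<bar>\<tau>\<bar>))"

lemma unit_vec_debias_row:
  assumes "unit_vec d x"
  shows "unit_vec (Suc d) (debias_row \<tau> d x)"
  unfolding debias_row_def
proof (rule unit_vec_lift_vec[OF assms])
  show "1 / sqrt (1 + \<bar>\<tau>\<bar>) * (1 / sqrt (1 + \<bar>\<tau>\<bar>))
      + sqrt \<bar>\<tau>\<bar> / sqrt (1 + \<bar>\<tau>\<bar>) * (sqrt \<bar>\<tau>\<bar> / sqrt (1 + \<bar>\<tau>\<bar>)) = 1"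
    by (simp add: field_simps)
qed

lemma unit_vec_debias_col:
  assumes "unit_vec d y"
  shows "unit_vec (Suc d) (debias_col \<tau> d y)"
  unfolding debias_col_def
proof (rule unit_vec_lift_vec[OF assms])
  show "1 / sqrt (1 + \<bar>\<tau>\<bar>) * (1 / sqrt (1 + \<bar>\<tau>\<bar>))
      + - sgn \<tau> * sqrt \<bar>\<tau>\<bar> / sqrt (1 + \<bar>\<tau>\<bar>) * (- sgn \<tau> * sqrt \<bar>\<tau>\<bar> / sqrt (1 + \<bar>\<tau>\<bar>)) = 1"
    by (cases "\<tau> = 0") (simp_all add: field_simps sgn_if)
qed

lemma dinner_debias:
  "dinner (Suc d) (debias_row \<tau> d x) (debias_col \<tau> d y) = (dinner d x y - \<tau>) / (1 + \<bar>\<tau>\<bar>)"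
proof -
  define s where "s = sqrt (1 + \<bar>\<tau>\<bar>)"
  have s: "s > 0" "s * s = 1 + \<bar>\<tau>\<bar>"
    unfolding s_def by simp_all
  have "dinner (Suc d) (debias_row \<tau> d x) (debias_col \<tau> d y)
      = 1 / s * (1 / s) * dinner d x y + sqrt \<bar>\<tau>\<bar> / s * (- sgn \<tau> * sqrt \<bar>\<tau>\<bar> / s)"
    unfolding debias_row_def debias_col_def dinner_lift_vec s_def ..
  also have "\<dots> = (dinner d x y - sgn \<tau> * (sqrt \<bar>\<tau>\<bar> * sqrt \<bar>\<tau>\<bar>)) / (s * s)"
    using s(1) by (simp add: field_simps)
  also have "sgn \<tau> * (sqrt \<bar>\<tau>\<bar> * sqrt \<bar>\<tau>\<bar>) = \<tau>"
    by (simp add: sgn_mult_abs)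
  finally show ?thesis
    unfolding s(2) .
qed

lemma is_embedding_debias:
  assumes "is_embedding N n A m \<tau> d U V"
  shows "is_embedding N n A (m / (1 + \<bar>\<tau>\<bar>)) 0 (Suc d)
           (\<lambda>j. debias_row \<tau> d (U j)) (\<lambda>i. debias_col \<tau> d (V i))"
proof -
  have pos: "1 + \<bar>\<tau>\<bar> > 0"
    by simp
  have "(dinner d x y - \<tau>) / (1 + \<bar>\<tau>\<bar>) \<ge> m / (1 + \<bar>\<tau>\<bar>)" if "dinner d x y \<ge> \<tau> + m" for x y
    using that pos by (intro divide_right_mono) auto
  moreover have "(dinner d x y - \<tau>) / (1 + \<bar>\<tau>\<bar>) \<le> - (m / (1 + \<bar>\<tau>\<bar>))" if "dinner d x y \<le> \<tau> - m" for x y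
    using that pos divide_right_mono[of "dinner d x y - \<tau>" "- m" "1 + \<bar>\<tau>\<bar>"] by simp
  ultimately show ?thesis
    using assms unfolding is_embedding_def dinner_debias
    by (simp add: unit_vec_debias_row unit_vec_debias_col)
qed

theorem propositionA1:
  fixes N n d :: nat and A :: "nat \<Rightarrow> nat \<Rightarrow> nat" and m \<tau> :: real
    and U V :: "nat \<Rightarrow> nat \<Rightarrow> real"
  assumes "binary_matrix N n A"
    and "m \<ge> 0"
    and "is_embedding N n A m \<tau> d U V"
  shows "(\<exists>U' V'. is_embedding N n A (m / (1 + \<bar>\<tau>\<bar>)) 0 (d + 1) U' V')
         \<and> (\<bar>\<tau>\<bar> \<le> 1 \<longrightarrow> m / (1 + \<bar>\<tau>\<bar>) \<ge> m / 2)"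
proof
  show "\<exists>U' V'. is_embedding N n A (m / (1 + \<bar>\<tau>\<bar>)) 0 (d + 1) U' V'"
    using is_embedding_debias[OF assms(3)] by auto
  show "\<bar>\<tau>\<bar> \<le> 1 \<longrightarrow> m / (1 + \<bar>\<tau>\<bar>) \<ge> m / 2"
    using assms(2) divide_left_mono[of "1 + \<bar>\<tau>\<bar>" 2 m] by simp
qed

end
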